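(* Let $K$ be a field, let $m\geq 1$ and let $f:\mathbb{N}_1\to\mathbb{N}_1$ be a function. Suppose that $I_1\subsetneq \dots\subsetneq I_t$ is an $f$-bounded ascending chain of ideals in $K[x_1,\dots,x_m]$ of length $t$. Let $g:\mathbb{N}_1\to\mathbb{N}_1$ be the non-decreasing function such that $g(n)$ is the greatest number of the set $\{f(1),f(2),\dots,f(n)\}$, for any $n\in\mathbb{N}_1$. Then $t\leq\mathcal{B}(m,g)$. In particular, $t\leq\mathcal{B}(m,f)$ if $f$ is non-decreasing.
   Context: $\mathbb{N}=\{0,1,2,\dots\}$ and $\mathbb{N}_1=\mathbb{N}\setminus\{0\}$. The degree of a polynomial is its total degree. For a function $f:\mathbb{N}_1\to\mathbb{N}_1$, an ascending chain $I_1\subsetneq\dots\subsetneq I_t$ of ideals in $K[x_1,\dots,x_m]$ is called $f$-bounded if, for every $j=1,\dots,t$, the ideal $I_j$ is generated by polynomials of degrees less than or equal to $f(j)$. Definition of $\mathcal{B}$. Let $\mathbb{F}$ be the set of all non-decreasing functions $\mathbb{N}_1\to\mathbb{N}_1$. For $f\in\mathbb{F}$ and $s\in\mathbb{N}$ let ${}^{s}f\in\mathbb{F}$ be given by ${}^{s}f(n)=f(s+n)$. The function $\mathcal{B}:\mathbb{N}_1\times\mathbb{F}\to\mathbb{N}$ is defined by recursion on $m$. Put $\mathcal{B}(1,f)=f(1)+1$. For $m\geq 2$, assuming that $\mathcal{B}(m-1,\cdot)$ is defined, define functions $\mathcal{B}_m^k:\mathbb{F}\times\mathbb{N}^k\to\mathbb{N}$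 for $k=m,m-1,\dots,0$ by backward recursion on $k$: (i) $\mathcal{B}_m^m(f,b_1,\dots,b_m)=(b_1+1)\cdots(b_m+1)$; (ii) for $0\leq k\leq m-1$, $f\in\mathbb{F}$ and $\beta\in\mathbb{N}^k$, let $h:\mathbb{N}_1\to\mathbb{N}_1$ be given by $h(1)=1$ and $h(n+1)=1+h(n)+\mathcal{B}_m^{k+1}\big({}^{h(n)}f,\beta,f(h(n))\big)$ for $n\geq 1$ (so $h\in\mathbb{F}$), and put $\mathcal{B}_m^k(f,\beta)=h\big(\mathcal{B}(m-1,f\circ h)+1\big)$. Finally, $\mathcal{B}(m,f)=\mathcal{B}_m^0(f)$ (for $k=0$ the tuple $\beta$ is empty).
   Formalization: For m=1 the first ideal I_1 is assumed nonzero; otherwise the bound fails, e.g. for f constantly 1 the f-bounded chain (0)⊊(x_1)⊊(1) has length 3 > B(1,f)=2. *)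

theory Defs
  imports "HOL-Library.Poly_Mapping" "HOL-Algebra.Ideal"
begin

text \<open>
  Multivariate polynomials with coefficients in \<open>'a\<close> are finitely supported maps from monomials to
  coefficients, where the monomials are the finitely supported exponent maps \<^typ>\<open>nat \<Rightarrow>\<^sub>0 nat\<close>; the
  variables \<open>x\<^sub>1, x\<^sub>2, \<dots>\<close> are indexed by the positive natural numbers.
\<close>

type_synonym 'a mpoly = "(nat \<Rightarrow>\<^sub>0 nat) \<Rightarrow>\<^sub>0 'a"

definition polynomial_ring :: "nat \<Rightarrow> ('a::field) mpoly ring" where
  "polynomial_ring m =
     \<lparr>carrier = {p. \<forall>t\<in>Poly_Mapping.keys p. Poly_Mapping.keys t \<subseteq> {1..m}},
      monoid.mult = (*), one = 1, zero = 0, add = (+)\<rparr>"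

definition monomial_degree :: "(nat \<Rightarrow>\<^sub>0 nat) \<Rightarrow> nat" where
  "monomial_degree t = (\<Sum>i\<in>Poly_Mapping.keys t. Poly_Mapping.lookup t i)"

text \<open>The zero polynomial gets degree 0. This is harmless below: removing 0 from a set of
  generators does not change the ideal.\<close>

definition total_degree :: "('a::field) mpoly \<Rightarrow> nat" where
  "total_degree p = Max (insert 0 (monomial_degree ` Poly_Mapping.keys p))"

lemma cring_polynomial_ring: "cring (polynomial_ring m :: ('a::field) mpoly ring)"
proof (rule cringI)
  let ?R = "polynomial_ring m :: 'a mpoly ring"
  have ops: "x \<oplus>\<^bsub>?R\<^esub> y = x + y" "x \<otimes>\<^bsub>?R\<^esub> y = x * y" "\<zero>\<^bsub>?R\<^esub> = 0" "\<one>\<^bsub>?R\<^esub> = 1" for x y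
    by (simp_all add: polynomial_ring_def)
  have units: "0 \<in> carrier ?R" "1 \<in> carrier ?R"
    by (simp_all add: polynomial_ring_def)
  have plus: "p + q \<in> carrier ?R" if "p \<in> carrier ?R" "q \<in> carrier ?R" for p q
    using that Poly_Mapping.keys_add[of p q] by (auto simp: polynomial_ring_def)
  have neg: "- p \<in> carrier ?R" if "p \<in> carrier ?R" for p
    using that by (auto simp: polynomial_ring_def)
  have times: "p * q \<in> carrier ?R" if "p \<in> carrier ?R" "q \<in> carrier ?R" for p q
  proof -
    have "Poly_Mapping.keys t \<subseteq> {1..m}" if t: "t \<in> Poly_Mapping.keys (p * q)" for t
    proof -
      obtain u v where "t = u + v" "u \<in> Poly_Mapping.keys p" "v \<in> Poly_Mapping.keys q"
        using t Poly_Mapping.keys_mult[of p q] by blast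
      then show ?thesis
        using \<open>p \<in> carrier ?R\<close> \<open>q \<in> carrier ?R\<close> Poly_Mapping.keys_add[of u v]
        by (fastforce simp: polynomial_ring_def)
    qed
    then show ?thesis by (simp add: polynomial_ring_def)
  qed
  show "abelian_group ?R"
  proof (rule abelian_groupI)
    fix x assume x: "x \<in> carrier ?R"
    show "\<exists>y\<in>carrier ?R. y \<oplus>\<^bsub>?R\<^esub> x = \<zero>\<^bsub>?R\<^esub>"
      by (rule bexI[OF _ neg[OF x]]) (simp add: ops)
  qed (simp_all add: ops units plus ac_simps)
  show "Group.comm_monoid ?R"
    by (rule comm_monoidI) (simp_all add: ops units times ac_simps)
qed (simp add: polynomial_ring_def distrib_right)

text \<open>
  \<open>I\<^sub>1 \<subset> \<dots> \<subset> I\<^sub>t\<close> is represented by a function of which only the values at \<open>1, \<dots>, t\<close> matter;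
  likewise a function on the positive natural numbers is a function on \<^typ>\<open>nat\<close> whose value at 0
  is never used.
\<close>

definition ascending_chain :: "nat \<Rightarrow> nat \<Rightarrow> (nat \<Rightarrow> ('a::field) mpoly set) \<Rightarrow> bool" where
  "ascending_chain m t I \<longleftrightarrow>
     (\<forall>j\<in>{1..t}. ideal (I j) (polynomial_ring m)) \<and> (\<forall>j\<in>{1..<t}. I j \<subset> I (Suc j))"

text \<open>
  The zero ideal is generated by the empty set (or by 0), so a bounded chain may start with it.
  For \<open>m = 1\<close> this would break the bound \<open>\<B> 1 f = f 1 + 1\<close>: if \<open>f\<close> is constantly 1, then
  \<open>(0) \<subset> (x\<^sub>1) \<subset> (1)\<close> is a bounded chain of length 3. Statements bounding the length by
  \<open>\<B> m f\<close> therefore need \<open>I\<^sub>1 \<noteq> {0}\<close> when \<open>m = 1\<close>.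
\<close>

definition bounded_chain ::
  "nat \<Rightarrow> (nat \<Rightarrow> nat) \<Rightarrow> nat \<Rightarrow> (nat \<Rightarrow> ('a::field) mpoly set) \<Rightarrow> bool" where
  "bounded_chain m f t I \<longleftrightarrow> ascending_chain m t I \<and>
     (\<forall>j\<in>{1..t}. \<exists>S \<subseteq> carrier (polynomial_ring m).
        (\<forall>p\<in>S. total_degree p \<le> f j) \<and> I j = genideal (polynomial_ring m) S)"

definition shift :: "nat \<Rightarrow> (nat \<Rightarrow> nat) \<Rightarrow> nat \<Rightarrow> nat" where
  "shift s f = (\<lambda>n. f (s + n))"

text \<open>
  \<open>\<B> m f\<close> is meant for \<open>m \<ge> 1\<close> and \<open>\<B>k m k f \<beta>\<close> for \<open>m \<ge> 2\<close>, \<open>k \<le> m\<close> and \<open>length \<beta> = k\<close>;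
  \<open>\<B>h m k f \<beta>\<close> is the auxiliary function \<open>h\<close> used to define \<open>\<B>k m k f \<beta>\<close> for \<open>k < m\<close>.
  The recursion makes sense for arbitrary \<open>f\<close>, hence no restriction to non-decreasing functions.
\<close>

function (sequential)
  \<B> :: "nat \<Rightarrow> (nat \<Rightarrow> nat) \<Rightarrow> nat" and
  \<B>k :: "nat \<Rightarrow> nat \<Rightarrow> (nat \<Rightarrow> nat) \<Rightarrow> nat list \<Rightarrow> nat" and
  \<B>h :: "nat \<Rightarrow> nat \<Rightarrow> (nat \<Rightarrow> nat) \<Rightarrow> nat list \<Rightarrow> nat \<Rightarrow> nat" where
  "\<B> m f = (if m \<le> 1 then f 1 + 1 else \<B>k m 0 f [])"
| "\<B>k m k f \<beta> =
     (if k \<ge> m then (\<Prod>b\<leftarrow>\<beta>. b + 1)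
      else \<B>h m k f \<beta> (\<B> (m - 1) (\<lambda>n. f (\<B>h m k f \<beta> n)) + 1))"
| "\<B>h m k f \<beta> n =
     (if k \<ge> m \<or> n \<le> 1 then 1
      else 1 + \<B>h m k f \<beta> (n - 1) +
        \<B>k m (k + 1) (shift (\<B>h m k f \<beta> (n - 1)) f) (\<beta> @ [f (\<B>h m k f \<beta> (n - 1))]))"
  by pat_completeness auto
termination
  by (relation "inv_image (less_than <*lex*> less_than <*lex*> less_than <*lex*> less_than)
      (\<lambda>x. case x of Inl (m, f) \<Rightarrow> (m, Suc m, 0, 0)
         | Inr (Inl (m, k, f, \<beta>)) \<Rightarrow> (m, m - k, 1, 0)
         | Inr (Inr (m, k, f, \<beta>, n)) \<Rightarrow> (m, m - k, 0, n))") auto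

declare \<B>.simps [simp del] \<B>k.simps [simp del] \<B>h.simps [simp del]

end

theory Submission
  imports Defs "HOL-Library.Product_Lexorder"
begin

text \<open>
  With respect to a graded monomial order, choose \<open>p\<^sub>j \<in> I\<^sub>j - I\<^bsub>j-1\<^esub>\<close> of degree at most \<open>f j\<close> with
  least leading monomial \<open>u\<^sub>j\<close>. Then no \<open>u\<^sub>j\<close> is divisible by an earlier \<open>u\<^sub>i\<close>, so it remains to bound
  the length of such sequences of exponent vectors.

  \<open>\<B>k m k f \<beta>\<close> bounds the length when \<open>k\<close> of the \<open>m\<close> coordinates are at most \<open>b\<^sub>1, \<dots>, b\<^sub>k\<close>.
  For \<open>k < m\<close> one drops a further coordinate \<open>c\<close> and selects greedily elements whose projections to
  the other \<open>m - 1\<close> coordinates still do not dominate each other: as long as the sequence is long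
  enough, the \<open>n\<close>-th one has index at most \<open>h n\<close>. The number of selected elements is bounded by
  \<open>\<B> (m - 1) (f \<circ> h)\<close>.

  If the chain starts with the zero ideal, there is no \<open>u\<^sub>1\<close>, and the sequence \<open>u\<^sub>2, u\<^sub>3, \<dots>\<close> keeps
  its indexing. The same selection, started at 2, reduces this case to two variables, where the
  bound has enough slack to absorb the missing term.
\<close>

subsection \<open>Leading monomials\<close>

lemma monomial_degree_eq_sum:
  assumes "finite A" "Poly_Mapping.keys t \<subseteq> A"
  shows "monomial_degree t = (\<Sum>i\<in>A. Poly_Mapping.lookup t i)"
  unfolding monomial_degree_def
  by (rule sum.mono_neutral_left) (use assms in \<open>auto simp: in_keys_iff\<close>)

lemma monomial_degree_add: "monomial_degree (s + t) = monomial_degree s + monomial_degree t"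
proof -
  let ?A = "Poly_Mapping.keys s \<union> Poly_Mapping.keys t"
  show ?thesis
    using Poly_Mapping.keys_add[of s t]
    by (simp add: monomial_degree_eq_sum[of ?A] Poly_Mapping.lookup_add sum.distrib)
qed

text \<open>Ensures that a least leading monomial can be chosen: the degree bound leaves finitely
  many candidates.\<close>

lemma finite_monomials_bounded_degree:
  assumes "finite A"
  shows "finite {t. Poly_Mapping.keys t \<subseteq> A \<and> monomial_degree t \<le> d}" (is "finite ?M")
proof (rule finite_imageD)
  let ?r = "\<lambda>t. restrict (Poly_Mapping.lookup t) A"
  have "?r ` ?M \<subseteq> (\<Pi>\<^sub>E i\<in>A. {..d})"
  proof (rule image_subsetI, rule restrict_PiE_iff[THEN iffD2], rule ballI)
    fix t i assume "t \<in> ?M" and "i \<in> A"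
    moreover have "Poly_Mapping.lookup t i \<le> (\<Sum>i\<in>A. Poly_Mapping.lookup t i)"
      by (rule member_le_sum) (use assms \<open>i \<in> A\<close> in auto)
    ultimately show "Poly_Mapping.lookup t i \<in> {..d}"
      using monomial_degree_eq_sum[OF assms, of t] by simp
  qed
  then show "finite (?r ` ?M)"
    by (rule finite_subset) (simp add: assms finite_PiE)
  show "inj_on ?r ?M"
  proof (rule inj_onI, rule poly_mapping_eqI)
    fix s t i assume *: "s \<in> ?M" "t \<in> ?M" "?r s = ?r t"
    show "Poly_Mapping.lookup s i = Poly_Mapping.lookup t i"
    proof (cases "i \<in> A")
      case True
      then show ?thesis using fun_cong[OF *(3), of i] by simp
    next
      case False
      then have "i \<notin> Poly_Mapping.keys s" "i \<notin> Poly_Mapping.keys t" using * by auto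
      then show ?thesis by (simp add: in_keys_iff)
    qed
  qed
qed

text \<open>The lexicographic order on these pairs yields a graded monomial order; ties in degree
  are broken by the translation-invariant linear order on monomials.\<close>

definition graded_key :: "(nat \<Rightarrow>\<^sub>0 nat) \<Rightarrow> nat \<times> (nat \<Rightarrow>\<^sub>0 nat)" where
  "graded_key t = (monomial_degree t, t)"

definition leading_monomial :: "('a::zero) mpoly \<Rightarrow> (nat \<Rightarrow>\<^sub>0 nat)" where
  "leading_monomial p = snd (Max (graded_key ` Poly_Mapping.keys p))"

lemma graded_key_add_left_le_iff:
  "graded_key (v + s) \<le> graded_key (v + t) \<longleftrightarrow> graded_key s \<le> graded_key t"
  by (auto simp: graded_key_def monomial_degree_add)

lemma graded_key_eq_iff: "graded_key s = graded_key t \<longleftrightarrow> s = t"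
  by (auto simp: graded_key_def)

lemma
  assumes "p \<noteq> 0"
  shows leading_monomial_in_keys: "leading_monomial p \<in> Poly_Mapping.keys p"
    and leading_monomial_greatest:
      "t \<in> Poly_Mapping.keys p \<Longrightarrow> graded_key t \<le> graded_key (leading_monomial p)"
proof -
  let ?K = "graded_key ` Poly_Mapping.keys p"
  have "Max ?K \<in> ?K" by (rule Max_in) (use assms in auto)
  then obtain s where s: "s \<in> Poly_Mapping.keys p" "Max ?K = graded_key s" by auto
  then have *: "leading_monomial p = s" by (simp add: leading_monomial_def graded_key_def)
  show "leading_monomial p \<in> Poly_Mapping.keys p" using s * by simp
  show "graded_key t \<le> graded_key (leading_monomial p)" if "t \<in> Poly_Mapping.keys p"
    unfolding * s(2)[symmetric] using that by simp
qed

lemma total_degree_le_iff: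
  "total_degree p \<le> d \<longleftrightarrow> (\<forall>t\<in>Poly_Mapping.keys p. monomial_degree t \<le> d)"
  by (simp add: total_degree_def)

lemma lookup_single_mult_add:
  fixes q :: "('a::field) mpoly"
  shows "Poly_Mapping.lookup (Poly_Mapping.single v c * q) (v + t) = c * Poly_Mapping.lookup q t"
  by (simp add: lookup_mult lookup_single when_mult)

lemma keys_single_mult_subset:
  "Poly_Mapping.keys (Poly_Mapping.single v c * q) \<subseteq> (+) v ` Poly_Mapping.keys (q :: ('a::field) mpoly)"
  using Poly_Mapping.keys_mult[of "Poly_Mapping.single v c" q] by (force split: if_splits)

text \<open>Minimality of the leading monomial takes the place of division with remainder: if it were
  divisible by the leading monomial of an element of \<open>I\<close>, a monomial multiple of that element could
  be subtracted. As the order is graded, this does not raise the degree.\<close>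

lemma ideal_extension_leading_monomial:
  fixes m :: nat and I J :: "('a::field) mpoly set"
  defines "R \<equiv> polynomial_ring m :: 'a mpoly ring"
  assumes I: "ideal I R" and J: "J = genideal R S" and sub: "I \<subset> J"
    and S: "S \<subseteq> carrier R" and deg: "\<forall>p\<in>S. total_degree p \<le> d"
  shows "\<exists>p\<in>J. p \<noteq> 0 \<and> total_degree p \<le> d \<and>
    (\<forall>q\<in>I. q \<noteq> 0 \<longrightarrow> (\<exists>c\<in>{1..m}. Poly_Mapping.lookup (leading_monomial p) c
      < Poly_Mapping.lookup (leading_monomial q) c))"
proof -
  interpret R: cring R unfolding R_def by (rule cring_polynomial_ring)
  interpret I: ideal I R by fact
  have "ideal J R" unfolding J using S by (rule R.genideal_ideal)
  then interpret J: ideal J R .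
  have ops: "x \<oplus>\<^bsub>R\<^esub> y = x + y" "x \<otimes>\<^bsub>R\<^esub> y = x * y" "\<zero>\<^bsub>R\<^esub> = 0" for x y
    by (simp_all add: R_def polynomial_ring_def)
  have carrier: "p \<in> carrier R \<longleftrightarrow> (\<forall>t\<in>Poly_Mapping.keys p. Poly_Mapping.keys t \<subseteq> {1..m})" for p
    by (simp add: R_def polynomial_ring_def)
  define P where "P = {p \<in> J - I. total_degree p \<le> d}"
  define L where "L = (\<lambda>p. graded_key (leading_monomial p)) ` P"
  have P: "p \<noteq> 0" "p \<in> J" "p \<notin> I" "p \<in> carrier R" "total_degree p \<le> d" if "p \<in> P" for p
    using that I.zero_closed J.Icarr by (auto simp: P_def ops)
  \<comment> \<open>If \<open>I\<close> contained all generators, it would contain \<open>J\<close>.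
    So some generator, of degree at most \<open>d\<close>, witnesses that \<open>P\<close> is
    nonempty.\<close>
  have "\<not> S \<subseteq> I"
    using R.genideal_minimal[OF I, of S] sub by (auto simp: J)
  moreover have "S \<subseteq> J" unfolding J using S by (rule R.genideal_self)
  ultimately have "P \<noteq> {}" using deg by (auto simp: P_def)
  then have "L \<noteq> {}" by (simp add: L_def)
  have "finite L"
  proof (rule finite_subset)
    show "L \<subseteq> graded_key ` {t. Poly_Mapping.keys t \<subseteq> {1..m} \<and> monomial_degree t \<le> d}"
      using P leading_monomial_in_keys carrier by (fastforce simp: L_def total_degree_le_iff)
  qed (simp add: finite_monomials_bounded_degree)
  then have "Min L \<in> L" using \<open>L \<noteq> {}\<close> by simp
  then obtain p where p: "p \<in> P" and min: "graded_key (leading_monomial p) = Min L"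
    by (auto simp: L_def)
  have min: "graded_key (leading_monomial p) \<le> graded_key (leading_monomial p')" if "p' \<in> P" for p'
    unfolding min using \<open>finite L\<close> that by (auto simp: L_def)
  let ?u = "leading_monomial p"
  note pP = P[OF p]
  have "\<exists>c\<in>{1..m}. Poly_Mapping.lookup ?u c < Poly_Mapping.lookup (leading_monomial q) c"
    if q: "q \<in> I" "q \<noteq> 0" for q
  proof (rule ccontr)
    let ?w = "leading_monomial q"
    assume "\<not> ?thesis"
    then have le: "Poly_Mapping.lookup ?w c \<le> Poly_Mapping.lookup ?u c" if "c \<in> {1..m}" for c
      using that by (meson not_less)
    have ukeys: "Poly_Mapping.keys ?u \<subseteq> {1..m}" and wkeys: "Poly_Mapping.keys ?w \<subseteq> {1..m}"
      using pP q I.Icarr leading_monomial_in_keys carrier by blast+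
    have le: "Poly_Mapping.lookup ?w c \<le> Poly_Mapping.lookup ?u c" for c
    proof (cases "c \<in> Poly_Mapping.keys ?w")
      case True
      then show ?thesis using le wkeys by blast
    qed (simp add: in_keys_iff)
    \<comment> \<open>The quotient monomial; \<open>le\<close> makes the truncated subtraction
      exact.\<close>
    define v where "v = ?u - ?w"
    have u: "v + ?w = ?u"
      by (rule poly_mapping_eqI) (simp add: v_def lookup_add lookup_minus le)
    have vkeys: "Poly_Mapping.keys v \<subseteq> {1..m}"
      using ukeys by (auto simp: v_def in_keys_iff lookup_minus)
    \<comment> \<open>Chosen so that the terms of \<open>p\<close> and \<open>r\<close> at
      \<open>?u\<close> cancel.\<close>
    define a where "a = - (Poly_Mapping.lookup p ?u / Poly_Mapping.lookup q ?w)"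
    define r where "r = Poly_Mapping.single v a * q"
    have "Poly_Mapping.single v a \<in> carrier R" using vkeys by (simp add: carrier)
    then have rI: "r \<in> I" using I.I_l_closed[OF q(1)] by (simp add: r_def ops)
    have "Poly_Mapping.lookup q ?w \<noteq> 0"
      using leading_monomial_in_keys[OF q(2)] by (simp add: in_keys_iff)
    then have cancel: "Poly_Mapping.lookup (p + r) ?u = 0"
      using lookup_single_mult_add[of v a q ?w] by (simp add: lookup_add r_def u a_def)
    have keys_le: "graded_key t \<le> graded_key ?u" if t: "t \<in> Poly_Mapping.keys (p + r)" for t
    proof -
      consider "t \<in> Poly_Mapping.keys p" | s where "s \<in> Poly_Mapping.keys q" "t = v + s"
        using t Poly_Mapping.keys_add[of p r] keys_single_mult_subset[of v a q]
        unfolding r_def by blast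
      then show ?thesis
      proof cases
        case 1
        then show ?thesis using pP(1) by (intro leading_monomial_greatest)
      next
        case 2
        then have "graded_key s \<le> graded_key ?w" using q(2) by (intro leading_monomial_greatest)
        then show ?thesis unfolding 2 u[symmetric] by (simp only: graded_key_add_left_le_iff)
      qed
    qed
    have "p + r \<in> J" using J.a_closed[OF pP(2)] rI sub by (auto simp: ops)
    moreover have "p + r \<notin> I"
    proof
      assume "p + r \<in> I"
      then have "p \<oplus>\<^bsub>R\<^esub> r \<in> I" by (simp add: ops)
      then have "(p \<oplus>\<^bsub>R\<^esub> r) \<oplus>\<^bsub>R\<^esub> (\<ominus>\<^bsub>R\<^esub> r) \<in> I"
        using I.a_inv_closed[OF rI] by (rule I.a_closed)
      moreover have "(p \<oplus>\<^bsub>R\<^esub> r) \<oplus>\<^bsub>R\<^esub> (\<ominus>\<^bsub>R\<^esub> r) = p"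
        using pP(4) I.Icarr[OF rI] by (simp add: R.a_assoc R.r_neg)
      ultimately show False using pP(3) by simp
    qed
    moreover have "total_degree (p + r) \<le> d"
    proof -
      have "monomial_degree ?u \<le> d"
        using pP leading_monomial_in_keys total_degree_le_iff by blast
      then show ?thesis using keys_le
        by (fastforce simp: total_degree_le_iff graded_key_def less_eq_prod_def)
    qed
    ultimately have pr: "p + r \<in> P" by (simp add: P_def)
    then have *: "leading_monomial (p + r) \<in> Poly_Mapping.keys (p + r)"
      by (intro leading_monomial_in_keys P(1))
    \<comment> \<open>Minimality in \<open>P\<close> and \<open>keys_le\<close> force the leading
      monomial to be \<open>?u\<close>, which has just been cancelled.\<close>
    then have "graded_key (leading_monomial (p + r)) = graded_key ?u"
      using keys_le min[OF pr] by (intro antisym)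
    then show False using * cancel by (simp add: graded_key_eq_iff in_keys_iff)
  qed
  then show ?thesis using pP by blast
qed

subsection \<open>Sequences of exponent vectors without later dominating terms\<close>

lemma \<B>h_1: "\<B>h m k f \<beta> (Suc 0) = 1"
  by (simp add: \<B>h.simps)

lemma \<B>h_Suc:
  "k < m \<Longrightarrow> n \<ge> 1 \<Longrightarrow> \<B>h m k f \<beta> (Suc n) = 1 + \<B>h m k f \<beta> n +
    \<B>k m (Suc k) (shift (\<B>h m k f \<beta> n) f) (\<beta> @ [f (\<B>h m k f \<beta> n)])"
  by (subst \<B>h.simps) simp

lemma \<B>h_ge: "k < m \<Longrightarrow> n \<le> \<B>h m k f \<beta> n"
proof (induction n)
  case (Suc n)
  then show ?case by (cases n) (simp_all add: \<B>h_1 \<B>h_Suc)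
qed simp

lemma \<B>h_pos: "k < m \<Longrightarrow> 1 \<le> \<B>h m k f \<beta> n"
  using \<B>h_ge[of k m n] by (cases n) (simp_all add: \<B>h.simps)

lemma \<B>h_mono:
  assumes "k < m" "i \<le> j"
  shows "\<B>h m k f \<beta> i \<le> \<B>h m k f \<beta> j"
  using assms(2)
proof (induction rule: dec_induct)
  case (step j)
  then show ?case using assms(1) by (cases "j = 0") (simp_all add: \<B>h.simps[of m k f \<beta> 0] \<B>h_1 \<B>h_Suc)
qed simp

text \<open>Keeping \<open>C\<close> and \<open>J\<close> as parameters makes dropping a coordinate
  or a missing first term a mere change of sets, without reindexing.\<close>

definition nowhere_dominating :: "'c set \<Rightarrow> nat set \<Rightarrow> (nat \<Rightarrow> 'c \<Rightarrow> nat) \<Rightarrow> bool" where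
  "nowhere_dominating C J u \<longleftrightarrow> (\<forall>i\<in>J. \<forall>j\<in>J. i < j \<longrightarrow> (\<exists>c\<in>C. u j c < u i c))"

definition degree_bounded :: "'c set \<Rightarrow> nat set \<Rightarrow> (nat \<Rightarrow> nat) \<Rightarrow> (nat \<Rightarrow> 'c \<Rightarrow> nat) \<Rightarrow> bool" where
  "degree_bounded C J f u \<longleftrightarrow> (\<forall>j\<in>J. (\<Sum>c\<in>C. u j c) \<le> f j)"

text \<open>The last index is bounded, not the number of terms, so \<open>a = 2\<close> covers
  chains starting with the zero ideal. The type argument fixes the type of coordinates.\<close>

definition \<B>_bounds_from :: "nat \<Rightarrow> 'c itself \<Rightarrow> nat \<Rightarrow> bool" where
  "\<B>_bounds_from m T a \<longleftrightarrow> (\<forall>(C :: 'c set) f s u. finite C \<longrightarrow> card C = m \<longrightarrow>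
     mono_on {1..} f \<longrightarrow> nowhere_dominating C {a..s} u \<longrightarrow> degree_bounded C {a..s} f u \<longrightarrow> s \<le> \<B> m f)"

lemma \<B>_bounds_fromD:
  fixes C :: "'c set"
  shows "\<B>_bounds_from m TYPE('c) a \<Longrightarrow> finite C \<Longrightarrow> card C = m \<Longrightarrow> mono_on {1..} f \<Longrightarrow>
    nowhere_dominating C {a..s} u \<Longrightarrow> degree_bounded C {a..s} f u \<Longrightarrow> s \<le> \<B> m f"
  unfolding \<B>_bounds_from_def by blast

lemma nowhere_dominatingD:
  "nowhere_dominating C J u \<Longrightarrow> i \<in> J \<Longrightarrow> j \<in> J \<Longrightarrow> i < j \<Longrightarrow> \<exists>c\<in>C. u j c < u i c"
  by (auto simp: nowhere_dominating_def)

lemma degree_boundedD: "degree_bounded C J f u \<Longrightarrow> j \<in> J \<Longrightarrow> (\<Sum>c\<in>C. u j c) \<le> f j"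
  by (auto simp: degree_bounded_def)

lemma coordinate_le:
  assumes "degree_bounded C J f u" "finite C" "j \<in> J" "c \<in> C"
  shows "u j c \<le> f j"
proof -
  have "u j c \<le> (\<Sum>c\<in>C. u j c)" by (rule member_le_sum) (use assms in auto)
  then show ?thesis using degree_boundedD[OF assms(1,3)] by simp
qed

text \<open>Windows are reindexed to start at 1 whatever \<open>a\<close> is; hence they only ever
  require bounds for sequences from 1.\<close>

lemma nowhere_dominating_shift:
  "nowhere_dominating C {a..s} u \<Longrightarrow> a \<le> h + 1 \<Longrightarrow> h + n \<le> s \<Longrightarrow>
    nowhere_dominating C {1..n} (\<lambda>j. u (h + j))"
  by (auto simp: nowhere_dominating_def)

lemma degree_bounded_shift:
  "degree_bounded C {a..s} f u \<Longrightarrow> a \<le> h + 1 \<Longrightarrow> h + n \<le> s \<Longrightarrow>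
    degree_bounded C {1..n} (shift h f) (\<lambda>j. u (h + j))"
  by (auto simp: degree_bounded_def shift_def)

lemma mono_on_shift: "mono_on {1..} f \<Longrightarrow> mono_on {1..} (shift h (f :: nat \<Rightarrow> nat))"
  by (auto simp: mono_on_def shift_def)

text \<open>Terms that do not dominate earlier ones are distinct, so the number of points of the box
  is a bound.\<close>

lemma card_box_bound:
  assumes "length cs = length \<beta>" "nowhere_dominating (set cs) {1..s} u"
    and box: "\<forall>j\<in>{1..s}. \<forall>i<length cs. u j (cs ! i) \<le> \<beta> ! i"
  shows "s \<le> (\<Prod>b\<leftarrow>\<beta>. b + 1)"
proof -
  let ?v = "\<lambda>j. \<lambda>i\<in>{..<length cs}. u j (cs ! i)"
  have "inj_on ?v {1..s}"
  proof (rule linorder_inj_onI')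
    fix i j assume "i \<in> {1..s}" "j \<in> {1..s}" "i < j"
    then obtain c where "c \<in> set cs" "u j c < u i c"
      using nowhere_dominatingD[OF assms(2)] by blast
    then obtain l where "l < length cs" "u j (cs ! l) < u i (cs ! l)"
      by (auto simp: in_set_conv_nth)
    then have "?v i l \<noteq> ?v j l" by simp
    then show "?v i \<noteq> ?v j" by metis
  qed
  then have "s = card (?v ` {1..s})" by (simp add: card_image)
  also have "\<dots> \<le> card (\<Pi>\<^sub>E i\<in>{..<length cs}. {..\<beta> ! i})"
  proof (rule card_mono)
    show "?v ` {1..s} \<subseteq> (\<Pi>\<^sub>E i\<in>{..<length cs}. {..\<beta> ! i})"
      by (rule image_subsetI, rule restrict_PiE_iff[THEN iffD2]) (use box in auto)
  qed (simp add: finite_PiE)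
  also have "\<dots> = (\<Prod>i<length \<beta>. \<beta> ! i + 1)" using assms(1) by (simp add: card_PiE)
  also have "\<dots> = (\<Prod>b\<leftarrow>\<beta>. b + 1)" by (simp add: prod.list_conv_set_nth atLeast0LessThan)
  finally show ?thesis .
qed

text \<open>If every element of the window \<open>(h n, h (n + 1)]\<close> dominated, outside the coordinate \<open>c\<close>, one of
  the elements selected so far, then all elements of the window would have their \<open>c\<close>-entry bounded by
  \<open>f (h n)\<close>, and the window would be too long. So a further element can be selected from it.\<close>

lemma \<B>k_step:
  fixes C :: "'c set"
  assumes C: "finite C" "card C = m" and k: "k < m" and a: "a \<ge> 1"
    and smaller: "\<B>_bounds_from (m - 1) TYPE('c) a"
    and window: "\<And>f \<beta> s u. mono_on {1..} f \<Longrightarrow> length \<beta> = Suc k \<Longrightarrow>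
      nowhere_dominating C {1..s} u \<Longrightarrow> degree_bounded C {1..s} f u \<Longrightarrow>
      \<forall>j\<in>{1..s}. \<forall>i<Suc k. u j ((cs @ [c]) ! i) \<le> \<beta> ! i \<Longrightarrow> s \<le> \<B>k m (Suc k) f \<beta>"
    and len: "length cs = k" "length \<beta> = k" and c: "c \<in> C"
    and f: "mono_on {1..} f"
    and nd: "nowhere_dominating C {a..s} u" and deg: "degree_bounded C {a..s} f u"
    and box: "\<forall>j\<in>{a..s}. \<forall>i<k. u j (cs ! i) \<le> \<beta> ! i"
  shows "s < \<B>k m k f \<beta>"
proof (rule ccontr)
  define h where "h = \<B>h m k f \<beta>"
  \<comment> \<open>One more than the number of selected elements that \<open>smaller\<close>
    permits.\<close>
  define N where "N = \<B> (m - 1) (\<lambda>n. f (h n)) + 1"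
  have h1: "h (Suc 0) = 1" and h_ge: "n \<le> h n" and h_pos: "1 \<le> h n"
    and h_mono: "i \<le> j \<Longrightarrow> h i \<le> h j"
    and h_Suc: "n \<ge> 1 \<Longrightarrow> h (Suc n) = 1 + h n + \<B>k m (Suc k) (shift (h n) f) (\<beta> @ [f (h n)])"
    for n i j
    using k \<B>h_1 \<B>h_ge \<B>h_pos \<B>h_mono \<B>h_Suc by (auto simp: h_def)
  have f_mono: "1 \<le> i \<Longrightarrow> i \<le> j \<Longrightarrow> f i \<le> f j" for i j
    using f by (auto simp: mono_on_def)
  assume "\<not> s < \<B>k m k f \<beta>"
  then have s: "h N \<le> s" using k by (subst (asm) \<B>k.simps) (simp add: h_def N_def)
  \<comment> \<open>\<open>d l\<close> is the index of the \<open>l\<close>-th selected element.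
    Selection is numbered from \<open>a\<close>, so that \<open>smaller\<close> applies to the
    result.\<close>
  have "\<exists>d. (\<forall>l\<in>{a..n}. d l \<in> {a..h l}) \<and> nowhere_dominating (C - {c}) {a..n} (\<lambda>l. u (d l))"
    if "n \<le> N" for n
    using that
  proof (induction n)
    case 0
    then show ?case using a by (auto simp: nowhere_dominating_def)
  next
    case (Suc n)
    then obtain d where d: "\<forall>l\<in>{a..n}. d l \<in> {a..h l}"
      and dn: "nowhere_dominating (C - {c}) {a..n} (\<lambda>l. u (d l))" by auto
    have hs: "h (Suc n) \<le> s" using h_mono[OF Suc.prems] s by simp
    consider "Suc n < a" | "Suc n = a" | "a \<le> n" by linarith
    then show ?case
    proof cases
      case 1
      then show ?thesis by (intro exI[of _ d]) (auto simp: nowhere_dominating_def)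
    next
      case 2
      then show ?thesis using h_ge[of a]
        by (intro exI[of _ "\<lambda>l. a"]) (auto simp: nowhere_dominating_def)
    next
      case 3
      define B where "B = \<B>k m (Suc k) (shift (h n) f) (\<beta> @ [f (h n)])"
      have hSuc: "h (Suc n) = h n + (1 + B)" using h_Suc[of n] 3 a by (simp add: B_def)
      have ah: "a \<le> h n" using h_ge[of n] 3 by simp
      have "\<exists>j\<in>{1..1 + B}. \<forall>l\<in>{a..n}. \<exists>c'\<in>C - {c}. u (h n + j) c' < u (d l) c'"
      proof (rule ccontr)
        assume "\<not> ?thesis"
        then have ex: "\<exists>l\<in>{a..n}. \<forall>c'\<in>C - {c}. u (d l) c' \<le> u (h n + j) c'" if "j \<in> {1..1 + B}" for j
          using that by (meson not_less)
        have c_le: "u (h n + j) c \<le> f (h n)" if j: "j \<in> {1..1 + B}" for j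
        proof -
          obtain l where l: "l \<in> {a..n}" and le: "\<forall>c'\<in>C - {c}. u (d l) c' \<le> u (h n + j) c'"
            using ex[OF j] by blast
          have dl: "a \<le> d l" "d l \<le> h n" using d l h_mono[of l n] by force+
          then have mem: "d l \<in> {a..s}" "h n + j \<in> {a..s}" "d l < h n + j"
            using hs hSuc j by auto
          then obtain c' where c': "c' \<in> C" "u (h n + j) c' < u (d l) c'"
            using nowhere_dominatingD[OF nd] by blast
          \<comment> \<open>The earlier term is dominated outside \<open>c\<close>, so the required
            descent can only happen at \<open>c\<close>.\<close>
          have "c' = c" using c' le by (metis Diff_iff not_less singletonD)
          moreover have "u (d l) c \<le> f (d l)" using deg C(1) mem(1) c by (rule coordinate_le)
          moreover have "f (d l) \<le> f (h n)" using a dl by (intro f_mono) auto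
          ultimately show ?thesis using c' by simp
        qed
        have "1 + B \<le> \<B>k m (Suc k) (shift (h n) f) (\<beta> @ [f (h n)])"
        proof (rule window)
          show "mono_on {1..} (shift (h n) f)" using f by (rule mono_on_shift)
          show "length (\<beta> @ [f (h n)]) = Suc k" using len by simp
          show "nowhere_dominating C {1..1 + B} (\<lambda>j. u (h n + j))"
            using nd ah hs hSuc by (intro nowhere_dominating_shift) auto
          show "degree_bounded C {1..1 + B} (shift (h n) f) (\<lambda>j. u (h n + j))"
            using deg ah hs hSuc by (intro degree_bounded_shift) auto
          show "\<forall>j\<in>{1..1 + B}. \<forall>i<Suc k. u (h n + j) ((cs @ [c]) ! i) \<le> (\<beta> @ [f (h n)]) ! i"
            using box c_le len ah hs hSuc by (auto simp: nth_append less_Suc_eq)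
        qed
        then show False by (simp add: B_def)
      qed
      then obtain j where j: "j \<in> {1..1 + B}"
        and new: "\<forall>l\<in>{a..n}. \<exists>c'\<in>C - {c}. u (h n + j) c' < u (d l) c'" by blast
      let ?d = "d(Suc n := h n + j)"
      have "\<forall>l\<in>{a..Suc n}. ?d l \<in> {a..h l}"
        using d j ah hSuc by (auto simp: le_Suc_eq)
      moreover have "nowhere_dominating (C - {c}) {a..Suc n} (\<lambda>l. u (?d l))"
        using dn new by (auto simp: nowhere_dominating_def le_Suc_eq)
      ultimately show ?thesis by blast
    qed
  qed
  then obtain d where d: "\<forall>l\<in>{a..N}. d l \<in> {a..h l}"
    and dn: "nowhere_dominating (C - {c}) {a..N} (\<lambda>l. u (d l))" by auto
  have "degree_bounded (C - {c}) {a..N} (\<lambda>n. f (h n)) (\<lambda>l. u (d l))"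
    unfolding degree_bounded_def
  proof
    fix l assume l: "l \<in> {a..N}"
    then have dl: "a \<le> d l" "d l \<le> h l" "h l \<le> h N" using d h_mono by auto
    have "(\<Sum>c\<in>C - {c}. u (d l) c) \<le> (\<Sum>c\<in>C. u (d l) c)" using C by (intro sum_mono2) auto
    also have "\<dots> \<le> f (d l)" using deg dl s by (intro degree_boundedD) auto
    also have "\<dots> \<le> f (h l)" using a dl by (intro f_mono) auto
    finally show "(\<Sum>c\<in>C - {c}. u (d l) c) \<le> f (h l)" .
  qed
  moreover have "mono_on {1..} (\<lambda>n. f (h n))"
    by (auto simp: mono_on_def intro!: f_mono h_mono h_pos)
  ultimately have "N \<le> \<B> (m - 1) (\<lambda>n. f (h n))"
    using C c dn by (intro \<B>_bounds_fromD[OF smaller, of "C - {c}"]) auto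
  then show False by (simp add: N_def)
qed

text \<open>Backward induction on \<open>k\<close>: for \<open>k = m\<close> the list
  \<open>cs\<close> exhausts \<open>C\<close> and points of a box are counted; below that,
  \<open>\<B>k_step\<close> passes to one more bounded coordinate. Windows change \<open>f\<close>,
  \<open>\<beta>\<close>, \<open>s\<close> and \<open>u\<close>, so these are generalized.\<close>

lemma \<B>k_bound:
  fixes C :: "'c set"
  assumes C: "finite C" "card C = m" and smaller: "\<B>_bounds_from (m - 1) TYPE('c) 1"
    and k: "k \<le> m"
    and cs: "distinct cs" "set cs \<subseteq> C" "length cs = k" and len: "length \<beta> = k"
    and f: "mono_on {1..} f"
    and nd: "nowhere_dominating C {1..s} u" and deg: "degree_bounded C {1..s} f u"
    and box: "\<forall>j\<in>{1..s}. \<forall>i<k. u j (cs ! i) \<le> \<beta> ! i"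
  shows "s \<le> \<B>k m k f \<beta>"
  using k cs len f nd deg box
proof (induction k arbitrary: cs \<beta> f s u rule: inc_induct)
  case base
  then have "set cs = C" using C by (metis card_subset_eq distinct_card)
  then show ?case using base card_box_bound[of cs \<beta> s u] by (subst \<B>k.simps) simp
next
  case (step k)
  have "card (set cs) < card C" using step C by (metis distinct_card)
  then obtain c where c: "c \<in> C" "c \<notin> set cs"
    using C by (metis card_mono leD List.finite_set subsetI)
  have "s < \<B>k m k f \<beta>"
  proof (rule \<B>k_step[OF C \<open>k < m\<close> order.refl smaller _ _ _ c(1)])
    fix f \<beta> s and u :: "nat \<Rightarrow> 'c \<Rightarrow> nat"
    assume "mono_on {1..} f" "length \<beta> = Suc k" "nowhere_dominating C {1..s} u"
      "degree_bounded C {1..s} f u" "\<forall>j\<in>{1..s}. \<forall>i<Suc k. u j ((cs @ [c]) ! i) \<le> \<beta> ! i"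
    then show "s \<le> \<B>k m (Suc k) f \<beta>"
      using step.prems c by (intro step.IH[of "cs @ [c]"]) auto
  qed (use step.prems in auto)
  then show ?case by simp
qed

text \<open>A single exponent must strictly decrease, starting from at most
  \<open>f 1\<close>.\<close>

lemma \<B>_bounds_from_1_base: "\<B>_bounds_from 1 TYPE('c) 1"
  unfolding \<B>_bounds_from_def
proof (intro allI impI)
  fix C :: "'c set" and f s u
  assume C: "finite C" "card C = 1" and f: "mono_on {1..} f"
    and nd: "nowhere_dominating C {1..s} u" and deg: "degree_bounded C {1..s} f u"
  obtain c where c: "C = {c}" using C by (auto simp: card_1_singleton_iff)
  have less: "u j c < u i c" if "i \<in> {1..s}" "j \<in> {1..s}" "i < j" for i j
    using nowhere_dominatingD[OF nd that] c by auto
  have "u j c \<le> f 1" if "j \<in> {1..s}" for j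
  proof -
    have "u 1 c \<le> f 1" by (rule coordinate_le[OF deg]) (use that c in auto)
    then show ?thesis using less[of 1 j] that by (cases "j = 1") auto
  qed
  moreover have "inj_on (\<lambda>j. u j c) {1..s}"
    by (rule linorder_inj_onI') (use less in fastforce)
  ultimately have "card {1..s} \<le> card {..f 1}"
    by (intro card_inj_on_le[of "\<lambda>j. u j c"]) auto
  then show "s \<le> \<B> 1 f" by (simp add: \<B>.simps)
qed

text \<open>For \<open>k = 0\<close> the box condition in \<open>\<B>k_bound\<close> is vacuous, so
  the bound for \<open>m\<close> variables yields the one for \<open>Suc m\<close>.\<close>

lemma \<B>_bounds_from_1: "m \<ge> 1 \<Longrightarrow> \<B>_bounds_from m TYPE('c) 1"
proof (induction m rule: dec_induct)
  case base
  show ?case by (rule \<B>_bounds_from_1_base)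
next
  case (step m)
  show ?case
    unfolding \<B>_bounds_from_def
  proof (intro allI impI)
    fix C :: "'c set" and f s u
    assume "finite C" "card C = Suc m" "mono_on {1..} f"
      "nowhere_dominating C {1..s} u" "degree_bounded C {1..s} f u"
    then have "s \<le> \<B>k (Suc m) 0 f []"
      using step by (intro \<B>k_bound[of C _ _ "[]"]) auto
    then show "s \<le> \<B> (Suc m) f" using step.hyps by (subst \<B>.simps) simp
  qed
qed

section \<open>Two variables, and sequences starting at index 2\<close>

text \<open>In two variables every element after the first one lies on one of the at most \<open>f 1\<close> lines parallel
  to the axes that separate it from the first one; \<open>line\<close> and \<open>pos\<close> encode this line and the
  position on it. As the positions decrease along a line, \<open>1 + (\<Sum>l\<in>L. cap l + 1)\<close> bounds the
  number of elements as long as only the lines in \<open>L\<close> are occupied.\<close>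

lemma lines_bound:
  fixes h :: "nat \<Rightarrow> nat" and line :: "nat \<Rightarrow> 'l"
  assumes h2: "1 < h 2" and h_Suc: "\<And>n. n \<ge> 2 \<Longrightarrow> h n + 1 + f (h n) \<le> h (Suc n)"
    and f: "mono_on {1..} f"
    and s: "1 \<le> s"
    and decr: "\<And>i j. 2 \<le> i \<Longrightarrow> i < j \<Longrightarrow> j \<le> s \<Longrightarrow> line i = line j \<Longrightarrow> pos j < pos i"
    and pos: "\<And>j. 2 \<le> j \<Longrightarrow> j \<le> s \<Longrightarrow> pos j \<le> f j"
  shows "s < h (card (line ` {2..s}) + 2)"
proof -
  let ?L = "\<lambda>j. line ` {2..j}"
  \<comment> \<open>The pairs of line and position are distinct; the summand 1 accounts for index 1,
    which lies on no line.\<close>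
  have count: "j \<le> 1 + (\<Sum>l\<in>?L j. cap l + 1)"
    if "j \<le> s" and cap: "\<forall>i\<in>{2..j}. pos i \<le> cap (line i)" for j cap
  proof -
    have "card {2..j} \<le> card (SIGMA l:?L j. {..cap l})"
    proof (rule card_inj_on_le)
      show "inj_on (\<lambda>i. (line i, pos i)) {2..j}"
        by (rule linorder_inj_onI') (use decr \<open>j \<le> s\<close> in fastforce)
    qed (use cap in auto)
    then show ?thesis by simp
  qed
  \<comment> \<open>Invariant of a sweep through the sequence: opening a new line costs at most one
    step of \<open>h\<close>. With no line occupied it starts at \<open>h 2\<close>.\<close>
  have "\<exists>cap. (\<forall>i\<in>{2..j}. pos i \<le> cap (line i)) \<and> 1 + (\<Sum>l\<in>?L j. cap l + 1) < h (card (?L j) + 2)"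
    if "1 \<le> j" "j \<le> s" for j
    using that
  proof (induction j rule: dec_induct)
    case base
    then show ?case using h2 by (simp add: numeral_2_eq_2)
  next
    case (step j)
    then obtain cap where cap: "\<forall>i\<in>{2..j}. pos i \<le> cap (line i)"
      and lt: "1 + (\<Sum>l\<in>?L j. cap l + 1) < h (card (?L j) + 2)" by auto
    have L: "?L (Suc j) = insert (line (Suc j)) (?L j)" using step by (simp add: atLeastAtMostSuc_conv)
    show ?case
    proof (cases "line (Suc j) \<in> ?L j")
      case True
      then obtain i where i: "i \<in> {2..j}" "line i = line (Suc j)" by force
      then have "pos (Suc j) < pos i" using step by (intro decr) auto
      then have "pos (Suc j) \<le> cap (line (Suc j))" using cap i by fastforce
      then show ?thesis using cap lt True L by (intro exI[of _ cap]) (auto simp: le_Suc_eq insert_absorb)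
    next
      case False
      \<comment> \<open>The count and the strict invariant place \<open>Suc j\<close> within the
        range of \<open>h\<close>, so a new line's capacity \<open>f (Suc j)\<close> is paid for by
        the next increment of \<open>h\<close>.\<close>
      have "j \<le> 1 + (\<Sum>l\<in>?L j. cap l + 1)" using step.prems cap by (intro count) auto
      then have "Suc j \<le> h (card (?L j) + 2)" using lt by simp
      then have f_le: "f (Suc j) \<le> f (h (card (?L j) + 2))" using f by (auto simp: mono_on_def)
      let ?cap = "cap(line (Suc j) := f (Suc j))"
      have "(\<Sum>l\<in>?L j. ?cap l + 1) = (\<Sum>l\<in>?L j. cap l + 1)"
        using False by (intro sum.cong) (metis fun_upd_other)+
      then have "1 + (\<Sum>l\<in>?L (Suc j). ?cap l + 1) = 1 + (\<Sum>l\<in>?L j. cap l + 1) + (f (Suc j) + 1)"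
        unfolding L using False by simp
      also have "\<dots> < h (Suc (card (?L j) + 2))"
        using lt f_le h_Suc[of "card (?L j) + 2"] by simp
      finally have "1 + (\<Sum>l\<in>?L (Suc j). ?cap l + 1) < h (card (?L (Suc j)) + 2)"
        unfolding L using False by simp
      moreover have "\<forall>i\<in>{2..Suc j}. pos i \<le> ?cap (line i)"
      proof
        fix i assume "i \<in> {2..Suc j}"
        then show "pos i \<le> ?cap (line i)"
        proof (cases "i = Suc j")
          case True
          then show ?thesis using pos[of "Suc j"] step by simp
        next
          case False
          then have "i \<in> {2..j}" using \<open>i \<in> {2..Suc j}\<close> by simp
          moreover from this have "line i \<noteq> line (Suc j)"
            using \<open>line (Suc j) \<notin> ?L j\<close> by (metis imageI)
          ultimately show ?thesis using cap by simp
        qed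
      qed
      ultimately show ?thesis by blast
    qed
  qed
  from this[OF s order.refl] obtain cap where cap: "\<forall>i\<in>{2..s}. pos i \<le> cap (line i)"
    and lt: "1 + (\<Sum>l\<in>?L s. cap l + 1) < h (card (?L s) + 2)" by auto
  then show ?thesis using count[OF order.refl cap] by linarith
qed

text \<open>At most \<open>f 1\<close> lines meet the later terms, while
  \<open>\<B>k 2 1 f [b]\<close> is \<open>h\<close> at \<open>f 1 + 2\<close>. For every
  \<open>b\<close>, the increments of \<open>h\<close> are large enough for
  \<open>lines_bound\<close>.\<close>

lemma two_variables_bound:
  assumes f: "mono_on {1..} f" and xy: "x \<noteq> y"
    and nd: "nowhere_dominating {x, y} {1..s} u" and deg: "degree_bounded {x, y} {1..s} f u"
  shows "s < \<B>k 2 1 f [b]"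
proof -
  define h where "h = \<B>h 2 1 f [b]"
  have B: "\<B>k 2 1 f [b] = h (f 1 + 2)"
    by (subst \<B>k.simps) (simp add: h_def \<B>.simps \<B>h_1)
  have h1: "h (Suc 0) = 1" by (simp add: h_def \<B>h_1)
  have h_Suc: "h (Suc n) = 1 + h n + (b + 1) * (f (h n) + 1)" if "n \<ge> 1" for n
    using that by (simp add: h_def \<B>h_Suc \<B>k.simps[of 2 "Suc (Suc 0)"])
  show ?thesis
  proof (cases "s = 0")
    case True
    then show ?thesis unfolding B using \<B>h_pos[of 1 2] by (simp add: h_def Suc_le_eq)
  next
    case False
    \<comment> \<open>A term not below the first one in \<open>x\<close> must be below it in
      \<open>y\<close>. On a common line one coordinate is fixed, so the other has to
      decrease.\<close>
    define line where "line j = (if u j x < u 1 x then (x, u j x) else (y, u j y))" for j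
    define pos where "pos j = (if u j x < u 1 x then u j y else u j x)" for j
    let ?K = "{x} \<times> {..<u 1 x} \<union> {y} \<times> {..<u 1 y}"
    have "s < h (card (line ` {2..s}) + 2)"
    proof (rule lines_bound)
      show "1 < h 2" using h_Suc[of 1] h1 by (simp add: numeral_2_eq_2)
      show "h n + 1 + f (h n) \<le> h (Suc n)" if "n \<ge> 2" for n
        using h_Suc[of n] that by simp
      show "pos j < pos i" if "2 \<le> i" "i < j" "j \<le> s" "line i = line j" for i j
        using nowhere_dominatingD[OF nd, of i j] that xy
        by (auto simp: line_def pos_def split: if_splits)
      show "pos j \<le> f j" if "2 \<le> j" "j \<le> s" for j
        using coordinate_le[OF deg, of j] that by (auto simp: pos_def)
    qed (use f False in auto)
    moreover have "card (line ` {2..s}) \<le> f 1"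
    proof -
      have "line ` {2..s} \<subseteq> ?K"
      proof (rule image_subsetI)
        fix j assume "j \<in> {2..s}"
        then show "line j \<in> ?K" using nowhere_dominatingD[OF nd, of 1 j] by (auto simp: line_def)
      qed
      then have "card (line ` {2..s}) \<le> card ?K" by (intro card_mono) auto
      also have "\<dots> \<le> u 1 x + u 1 y"
        by (rule order_trans[OF card_Un_le]) (simp add: card_cartesian_product)
      also have "\<dots> \<le> f 1" using degree_boundedD[OF deg, of 1] xy False by simp
      finally show ?thesis .
    qed
    ultimately show ?thesis
      unfolding B h_def using \<B>h_mono[of 1 2 "card (line ` {2..s}) + 2" "f 1 + 2" f "[b]"] by simp
  qed
qed

text \<open>Shifting by 1 makes the sequence start at 1, and \<open>h 2\<close> already exceeds the
  resulting bound by 2, which absorbs the lost index. The induction starts here because the claim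
  fails in one variable.\<close>

lemma \<B>_bounds_from_2_base: "\<B>_bounds_from 2 TYPE('c) 2"
  unfolding \<B>_bounds_from_def
proof (intro allI impI)
  fix C :: "'c set" and f s u
  assume C: "finite C" "card C = 2" and f: "mono_on {1..} f"
    and nd: "nowhere_dominating C {2..s} u" and deg: "degree_bounded C {2..s} f u"
  obtain x y where xy: "C = {x, y}" "x \<noteq> y" using C by (auto simp: card_2_iff)
  define h where "h = \<B>h 2 0 f []"
  have h2: "h 2 = 2 + \<B>k 2 1 (shift 1 f) [f 1]"
    unfolding numeral_2_eq_2 h_def by (simp add: \<B>h_Suc \<B>h_1)
  have "s - 1 < \<B>k 2 1 (shift 1 f) [f 1]"
  proof (cases "s = 0")
    case True
    then show ?thesis
      using two_variables_bound[of "shift 1 f" x y 0 u] mono_on_shift[OF f] xy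
      by (simp add: nowhere_dominating_def degree_bounded_def)
  next
    case False
    then show ?thesis
      using nowhere_dominating_shift[OF nd, of 1 "s - 1"] degree_bounded_shift[OF deg, of 1 "s - 1"] xy
      by (intro two_variables_bound[OF mono_on_shift[OF f] xy(2)]) auto
  qed
  then have "s \<le> h 2" using h2 by simp
  also have "\<dots> \<le> h (f 1 + 2)" unfolding h_def by (rule \<B>h_mono) auto
  also have "\<dots> = \<B> 2 f" unfolding h_def
    by (simp add: \<B>.simps \<B>k.simps[of 2 0] \<B>h_1)
  finally show "s \<le> \<B> 2 f" .
qed

text \<open>Only the selected subsequence starts at 2 and uses the induction hypothesis; the windows
  start at 1 and are handled by \<open>\<B>_bounds_from_1\<close>.\<close>

lemma \<B>_bounds_from_2: "m \<ge> 2 \<Longrightarrow> \<B>_bounds_from m TYPE('c) 2"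
proof (induction m rule: dec_induct)
  case base
  show ?case by (rule \<B>_bounds_from_2_base)
next
  case (step m)
  show ?case
    unfolding \<B>_bounds_from_def
  proof (intro allI impI)
    fix C :: "'c set" and f s u
    assume C: "finite C" "card C = Suc m" and *: "mono_on {1..} f"
      "nowhere_dominating C {2..s} u" "degree_bounded C {2..s} f u"
    obtain c where c: "c \<in> C" using C by fastforce
    have "s < \<B>k (Suc m) 0 f []"
    proof (rule \<B>k_step[OF C _ _ _ _ _ _ c, of 0 2 "[]"])
      fix f \<beta> s and u :: "nat \<Rightarrow> 'c \<Rightarrow> nat"
      assume "mono_on {1..} f" "length \<beta> = Suc 0" "nowhere_dominating C {1..s} u"
        "degree_bounded C {1..s} f u" "\<forall>j\<in>{1..s}. \<forall>i<Suc 0. u j (([] @ [c]) ! i) \<le> \<beta> ! i"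
      then show "s \<le> \<B>k (Suc m) (Suc 0) f \<beta>"
        using C c \<B>_bounds_from_1[of m, where 'c = 'c] step.hyps
        by (intro \<B>k_bound[of C _ _ "[c]"]) auto
    qed (use * step in auto)
    then show "s \<le> \<B> (Suc m) f" using step.hyps by (subst \<B>.simps) simp
  qed
qed

subsection \<open>Chains of ideals\<close>

text \<open>The majorant \<open>F\<close> serves both claims of the theorem: it becomes the running
  maximum \<open>g\<close>, or \<open>f\<close> itself.\<close>

lemma bounded_chain_length:
  fixes I :: "nat \<Rightarrow> ('a::field) mpoly set"
  assumes m: "m \<ge> 1" and chain: "bounded_chain m f t I" and nonzero: "m = 1 \<Longrightarrow> I 1 \<noteq> {0}"
    and F: "mono_on {1..} F" and le: "\<And>j. j \<ge> 1 \<Longrightarrow> f j \<le> F j"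
  shows "t \<le> \<B> m F"
proof -
  let ?R = "polynomial_ring m :: 'a mpoly ring"
  define a :: nat where "a = (if I 1 = {0} then 2 else 1)"
  \<comment> \<open>The preceding ideal; taking \<open>{0}\<close> before \<open>I 1\<close> treats
    the first nonzero ideal like the others, its divisibility condition being vacuous.\<close>
  define I' where "I' j = (if j = 1 then {0} else I (j - 1))" for j
  have ideal: "ideal (I j) ?R" if "j \<in> {1..t}" for j
    using chain that by (auto simp: bounded_chain_def ascending_chain_def)
  have strict: "I j \<subset> I (Suc j)" if "1 \<le> j" "Suc j \<le> t" for j
    using chain that by (simp add: bounded_chain_def ascending_chain_def)
  have mono: "I i \<subseteq> I j" if "i \<le> j" "1 \<le> i" "j \<le> t" for i j
    using that
  proof (induction j rule: dec_induct)
    case (step j)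
    then have "I i \<subseteq> I j" "I j \<subset> I (Suc j)" using strict by simp_all
    then show ?case by blast
  qed simp
  have zero: "0 \<in> I j" if "j \<in> {1..t}" for j
    using additive_subgroup.zero_closed[OF ideal.axioms(1)[OF ideal[OF that]]]
    by (simp add: polynomial_ring_def)
  have zero_ideal: "ideal {0} ?R"
    using ring.zeroideal[OF cring.axioms(1)[OF cring_polynomial_ring[of m]]]
    by (simp add: polynomial_ring_def)
  have "\<forall>j\<in>{a..t}. \<exists>p\<in>I j. p \<noteq> 0 \<and> total_degree p \<le> f j \<and>
    (\<forall>q\<in>I' j. q \<noteq> 0 \<longrightarrow> (\<exists>c\<in>{1..m}. Poly_Mapping.lookup (leading_monomial p) c
      < Poly_Mapping.lookup (leading_monomial q) c))"
  proof
    fix j assume j: "j \<in> {a..t}"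
    then have j1: "j \<in> {1..t}" by (auto simp: a_def split: if_splits)
    then obtain S where "S \<subseteq> carrier ?R" "\<forall>p\<in>S. total_degree p \<le> f j" "I j = genideal ?R S"
      using chain unfolding bounded_chain_def by blast
    moreover have "ideal (I' j) ?R"
    proof (cases "j = 1")
      case False
      then have "j - 1 \<in> {1..t}" using j1 by auto
      then show ?thesis using False ideal by (simp add: I'_def)
    qed (simp add: I'_def zero_ideal)
    moreover have "I' j \<subset> I j"
    proof (cases "j = 1")
      case True
      then have "I j \<noteq> {0}" using j by (auto simp: a_def split: if_splits)
      then show ?thesis using True zero[OF j1] by (auto simp: I'_def)
    next
      case False
      then have "1 \<le> j - 1" "Suc (j - 1) = j" using j1 by auto
      then show ?thesis using False strict[of "j - 1"] j1 by (simp add: I'_def)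
    qed
    ultimately show "\<exists>p\<in>I j. p \<noteq> 0 \<and> total_degree p \<le> f j \<and>
      (\<forall>q\<in>I' j. q \<noteq> 0 \<longrightarrow> (\<exists>c\<in>{1..m}. Poly_Mapping.lookup (leading_monomial p) c
        < Poly_Mapping.lookup (leading_monomial q) c))"
      by (intro ideal_extension_leading_monomial)
  qed
  then obtain p where p: "\<forall>j\<in>{a..t}. p j \<in> I j \<and> p j \<noteq> 0 \<and> total_degree (p j) \<le> f j \<and>
    (\<forall>q\<in>I' j. q \<noteq> 0 \<longrightarrow> (\<exists>c\<in>{1..m}. Poly_Mapping.lookup (leading_monomial (p j)) c
      < Poly_Mapping.lookup (leading_monomial q) c))"
    by metis
  define u where "u j = Poly_Mapping.lookup (leading_monomial (p j))" for j
  have a1: "1 \<le> a" by (simp add: a_def)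
  have "nowhere_dominating {1..m} {a..t} u"
    unfolding nowhere_dominating_def
  proof (intro ballI impI)
    fix i j assume ij: "i \<in> {a..t}" "j \<in> {a..t}" "i < j"
    \<comment> \<open>An earlier \<open>p i\<close> lies in the ideal preceding \<open>I j\<close>,
      so its leading monomial cannot divide that of \<open>p j\<close>.\<close>
    have "i \<le> j - 1" "1 \<le> i" "j - 1 \<le> t" using ij a1 by auto
    then have "I i \<subseteq> I (j - 1)" by (rule mono)
    moreover have "p i \<in> I i" using p ij by blast
    ultimately have "p i \<in> I' j" using ij a1 by (auto simp: I'_def)
    then show "\<exists>c\<in>{1..m}. u j c < u i c" using p ij by (simp add: u_def)
  qed
  moreover have "degree_bounded {1..m} {a..t} F u"
    unfolding degree_bounded_def
  proof
    fix j assume j: "j \<in> {a..t}"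
    then have lm: "leading_monomial (p j) \<in> Poly_Mapping.keys (p j)"
      using p by (simp add: leading_monomial_in_keys)
    have "p j \<in> I j" "j \<in> {1..t}" using p j a1 by auto
    then have "p j \<in> carrier ?R" using ideal.Icarr[OF ideal] by blast
    then have "Poly_Mapping.keys (leading_monomial (p j)) \<subseteq> {1..m}"
      using lm by (simp add: polynomial_ring_def)
    then have "(\<Sum>c\<in>{1..m}. u j c) = monomial_degree (leading_monomial (p j))"
      unfolding u_def by (simp add: monomial_degree_eq_sum[of "{1..m}"])
    also have "\<dots> \<le> f j" using p j lm by (simp add: total_degree_le_iff)
    also have "\<dots> \<le> F j" using j a1 by (intro le) auto
    finally show "(\<Sum>c\<in>{1..m}. u j c) \<le> F j" .
  qed
  moreover have "\<B>_bounds_from m TYPE(nat) a"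
  proof (cases "I 1 = {0}")
    case True
    then have "m \<ge> 2" using m nonzero by linarith
    then show ?thesis using True by (simp add: a_def \<B>_bounds_from_2)
  next
    case False
    then show ?thesis using m \<B>_bounds_from_1[of m] by (simp add: a_def)
  qed
  ultimately show ?thesis using F by (intro \<B>_bounds_fromD[of m a "{1..m}"]) auto
qed

theorem theorem4p2:
  fixes m t :: nat and f g :: "nat \<Rightarrow> nat"
    and I :: "nat \<Rightarrow> ('a::field) mpoly set"
  assumes m: "m \<ge> 1"
    and f: "\<And>n. n \<ge> 1 \<Longrightarrow> f n \<ge> 1"
    and chain: "bounded_chain m f t I"
    and nonzero: "m = 1 \<Longrightarrow> I 1 \<noteq> {0}"
    and g: "\<And>n. n \<ge> 1 \<Longrightarrow> g n = Max (f ` {1..n})"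
  shows "t \<le> \<B> m g \<and> (mono_on {1..} f \<longrightarrow> t \<le> \<B> m f)"
proof (intro conjI impI)
  have "mono_on {1..} g"
  proof (rule mono_onI)
    fix i j :: nat assume "i \<in> {1..}" "j \<in> {1..}" "i \<le> j"
    then show "g i \<le> g j" by (auto simp: g intro!: Max_mono)
  qed
  moreover have "f j \<le> g j" if "j \<ge> 1" for j
    using that by (auto simp: g intro!: Max_ge)
  ultimately show "t \<le> \<B> m g" using m chain nonzero by (intro bounded_chain_length)
next
  assume "mono_on {1..} f"
  then show "t \<le> \<B> m f" using m chain nonzero by (intro bounded_chain_length) auto
qed

end
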